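(* There exist a Hilbert space $H$ and a closed densely defined linear operator $T : D(T) \subset H \to H$ such that both $T$ and its adjoint $T^*$ are one-to-one and paranormal, yet $T$ is not normal.
   Context: Operators are linear and possibly unbounded. A linear operator $A$ with domain $D(A)$, a linear subspace of a Hilbert space $H$, is densely defined if $\overline{D(A)} = H$, and closed if its graph is closed in $H \oplus H$. The domain of $A^2$ is the natural one: $D(A^2) = \{x \in D(A) : Ax \in D(A)\}$. A linear operator $A : D(A) \subset H \to H$ is called paranormal if $\|Ax\|^2 \leq \|A^2 x\|\,\|x\|$ for all $x \in D(A^2)$ (no density of $D(A^2)$ is required). A densely defined linear operator $A$ is called normal if $A$ is closed and $AA^* = A^*A$ (equality of unbounded operators, including equality of their natural domains); equivalently, for $A$ closed and densely defined, $D(A) = D(A^* )$ and $\|Ax\| = \|A^*x\|$ for all $x \in D(A)$. *)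

theory Defs
  imports
    "HOL-Analysis.Analysis"
    "HOL-Algebra.Module"
    "HOL-Algebra.Algebraic_Closure_Type"
begin

section \<open>Complex Hilbert spaces\<close>

abbreviation complex_ring :: "complex ring" where
  "complex_ring \<equiv> ring_of_type_algebra"

text \<open>
  Spaces carry their own operations on an explicit carrier set, so that one can quantify over
  Hilbert spaces inside a formula.  As for every module of HOL-Algebra, the ring
  fields \<^term>\<open>monoid.mult\<close> and \<^term>\<open>one\<close> of the record are unused.
\<close>

record 'a cinner_space = "(complex, 'a) module" +
  cinner :: "'a \<Rightarrow> 'a \<Rightarrow> complex"

definition hnorm :: "('a, 'm) cinner_space_scheme \<Rightarrow> 'a \<Rightarrow> real" where
  "hnorm H x = sqrt (Re (cinner H x x))"

text \<open>
  The locale \<^locale>\<open>Metric_space\<close> wants distances that are nonnegative and symmetric on the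
  whole type, hence the value \<open>0\<close> outside of the carrier.
\<close>

definition hdist :: "('a, 'm) cinner_space_scheme \<Rightarrow> 'a \<Rightarrow> 'a \<Rightarrow> real" where
  "hdist H x y =
     (if x \<in> carrier H \<and> y \<in> carrier H then hnorm H (x \<ominus>\<^bsub>H\<^esub> y) else 0)"

locale complex_inner_product_space = module complex_ring H
  for H :: "('a, 'm) cinner_space_scheme" (structure) +
  assumes cinner_commute:
      "\<lbrakk>x \<in> carrier H; y \<in> carrier H\<rbrakk> \<Longrightarrow> cinner H y x = cnj (cinner H x y)"
    and cinner_add_left:
      "\<lbrakk>x \<in> carrier H; y \<in> carrier H; z \<in> carrier H\<rbrakk>
        \<Longrightarrow> cinner H (x \<oplus> y) z = cinner H x z + cinner H y z"
    and cinner_smult_left: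
      "\<lbrakk>x \<in> carrier H; y \<in> carrier H\<rbrakk> \<Longrightarrow> cinner H (a \<odot> x) y = a * cinner H x y"
    and cinner_nonneg: "x \<in> carrier H \<Longrightarrow> 0 \<le> Re (cinner H x x)"
    and cinner_definite: "\<lbrakk>x \<in> carrier H; cinner H x x = 0\<rbrakk> \<Longrightarrow> x = \<zero>"

locale complex_hilbert_space = complex_inner_product_space +
  assumes complete: "Metric_space.mcomplete (carrier H) (hdist H)"

text \<open>
  The distance is indeed a metric on the carrier, so that the topological notions
  of \<^locale>\<open>Metric_space\<close> used here have their usual meaning.
\<close>

context complex_inner_product_space
begin

lemma complex_ring_simps [simp]:
  "carrier (complex_ring) = UNIV" "a \<oplus>\<^bsub>complex_ring\<^esub> b = a + b"
  "a \<otimes>\<^bsub>complex_ring\<^esub> b = a * b" "\<one>\<^bsub>complex_ring\<^esub> = 1" "\<zero>\<^bsub>complex_ring\<^esub> = 0"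
  by (simp_all add: ring_of_type_algebra_def)

lemma smult_carrier: "x \<in> carrier H \<Longrightarrow> a \<odot> x \<in> carrier H"
  using smult_closed by simp

lemma smult_zero_left: "x \<in> carrier H \<Longrightarrow> 0 \<odot> x = \<zero>"
  using smult_l_null by simp

lemma smult_minus_one: assumes "x \<in> carrier H" shows "\<ominus> x = (-1) \<odot> x"
proof -
  have "(-1) \<odot> x \<oplus> x = (-1) \<odot> x \<oplus> 1 \<odot> x"
    using assms smult_one by simp
  also have "\<dots> = (-1 + 1) \<odot> x"
    using assms smult_l_distr[of "-1" 1 x] by (simp del: add.left_inverse)
  also have "\<dots> = \<zero>"
    using assms smult_zero_left by simp
  finally show ?thesis
    using assms smult_carrier M.minus_equality by blast
qed

lemma cinner_add_right:
  assumes "x \<in> carrier H" "y \<in> carrier H" "z \<in> carrier H"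
  shows "cinner H z (x \<oplus> y) = cinner H z x + cinner H z y"
  using assms cinner_commute[of "x \<oplus> y" z] cinner_commute[of x z] cinner_commute[of y z]
  by (simp add: cinner_add_left)

lemma cinner_smult_right:
  assumes "x \<in> carrier H" "y \<in> carrier H"
  shows "cinner H y (a \<odot> x) = cnj a * cinner H y x"
  using assms cinner_commute[of "a \<odot> x" y] cinner_commute[of x y] smult_carrier
  by (simp add: cinner_smult_left)

lemma hnorm_nonneg: "x \<in> carrier H \<Longrightarrow> 0 \<le> hnorm H x"
  by (simp add: hnorm_def cinner_nonneg)

lemma hnorm_sq: "x \<in> carrier H \<Longrightarrow> (hnorm H x)\<^sup>2 = Re (cinner H x x)"
  by (simp add: hnorm_def cinner_nonneg)

lemma cinner_self_eq_norm:
  assumes "x \<in> carrier H" shows "cinner H x x = of_real ((hnorm H x)\<^sup>2)"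
proof -
  have "Im (cinner H x x) = 0"
    using cinner_commute[OF assms assms] by (metis cnj.simps(2) equal_neg_zero)
  then show ?thesis
    using hnorm_sq[OF assms] by (simp add: complex_eq_iff)
qed

lemma hnorm_eq_zero: assumes "x \<in> carrier H" shows "hnorm H x = 0 \<longleftrightarrow> x = \<zero>"
proof
  assume "hnorm H x = 0"
  then show "x = \<zero>"
    using cinner_self_eq_norm[OF assms] cinner_definite[OF assms] by simp
next
  assume "x = \<zero>"
  then have "cinner H x x = 0"
    using cinner_smult_left[of x x 0] assms smult_zero_left by simp
  then show "hnorm H x = 0" by (simp add: hnorm_def)
qed

lemma hnorm_smult:
  assumes "x \<in> carrier H" shows "hnorm H (a \<odot> x) = cmod a * hnorm H x"
proof -
  have "cinner H (a \<odot> x) (a \<odot> x) = (a * cnj a) * cinner H x x"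
    using assms smult_carrier by (simp add: cinner_smult_left cinner_smult_right)
  also have "\<dots> = of_real ((cmod a)\<^sup>2 * (hnorm H x)\<^sup>2)"
    unfolding cinner_self_eq_norm[OF assms] complex_norm_square[symmetric]
    by simp
  finally have "Re (cinner H (a \<odot> x) (a \<odot> x)) = (cmod a)\<^sup>2 * (hnorm H x)\<^sup>2"
    by (simp only: Re_complex_of_real)
  then show ?thesis
    using hnorm_nonneg[OF assms] by (simp add: hnorm_def real_sqrt_mult)
qed

lemma hnorm_add_sq:
  assumes "x \<in> carrier H" "y \<in> carrier H"
  shows "(hnorm H (x \<oplus> y))\<^sup>2 = (hnorm H x)\<^sup>2 + 2 * Re (cinner H x y) + (hnorm H y)\<^sup>2"
  using assms cinner_commute[OF assms]
  by (simp add: hnorm_sq cinner_add_left cinner_add_right)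

lemma Re_cinner_le:
  assumes x: "x \<in> carrier H" and y: "y \<in> carrier H"
  shows "Re (cinner H x y) \<le> hnorm H x * hnorm H y"
proof (cases "hnorm H x = 0 \<or> hnorm H y = 0")
  case True
  then have "x = \<zero> \<or> y = \<zero>" using hnorm_eq_zero x y by blast
  then have "cinner H x y = 0"
    using cinner_smult_left[OF x y, of 0] cinner_smult_right[OF y x, of 0] smult_zero_left x y
    by auto
  then show ?thesis using True by auto
next
  case False
  define a b where "a = hnorm H x" and "b = hnorm H y"
  have pos: "a > 0" "b > 0"
    using False hnorm_nonneg x y by (auto simp: a_def b_def order.strict_iff_order)
  let ?u = "complex_of_real b \<odot> x" and ?v = "complex_of_real (- a) \<odot> y"
  have uv: "?u \<in> carrier H" "?v \<in> carrier H" using x y smult_carrier by blast+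
  have norms: "hnorm H ?u = b * a" "hnorm H ?v = a * b"
    using pos hnorm_smult[OF x] hnorm_smult[OF y] by (simp_all add: a_def b_def)
  have ip: "cinner H ?u ?v = of_real (- (a * b)) * cinner H x y"
    using cinner_smult_left[OF x uv(2)] cinner_smult_right[OF y x] by simp
  have re: "Re (cinner H ?u ?v) = - (a * b) * Re (cinner H x y)"
    unfolding ip by simp
  have "0 \<le> (hnorm H (?u \<oplus> ?v))\<^sup>2" by simp
  also have "\<dots> = (b * a)\<^sup>2 + 2 * (- (a * b) * Re (cinner H x y)) + (a * b)\<^sup>2"
    unfolding hnorm_add_sq[OF uv] norms re ..
  finally have "(a * b) * Re (cinner H x y) \<le> (a * b) * (a * b)"
    by (simp add: power2_eq_square algebra_simps)
  then show ?thesis using pos by (simp add: a_def b_def)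
qed

lemma hnorm_triangle:
  assumes "x \<in> carrier H" "y \<in> carrier H"
  shows "hnorm H (x \<oplus> y) \<le> hnorm H x + hnorm H y"
proof (rule power2_le_imp_le)
  show "(hnorm H (x \<oplus> y))\<^sup>2 \<le> (hnorm H x + hnorm H y)\<^sup>2"
    using Re_cinner_le[OF assms] hnorm_add_sq[OF assms] by (simp add: power2_sum)
qed (use assms hnorm_nonneg in simp)

lemma minus_add_cancel:
  assumes "x \<in> carrier H" "y \<in> carrier H" "z \<in> carrier H"
  shows "(x \<ominus> y) \<oplus> (y \<ominus> z) = x \<ominus> z"
proof -
  have "(x \<ominus> y) \<oplus> (y \<ominus> z) = x \<oplus> (\<ominus> y \<oplus> (y \<oplus> \<ominus> z))"
    unfolding M.minus_eq using assms by (intro M.a_assoc M.a_inv_closed M.a_closed)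
  also have "\<ominus> y \<oplus> (y \<oplus> \<ominus> z) = (\<ominus> y \<oplus> y) \<oplus> \<ominus> z"
    using assms by (intro M.a_assoc[symmetric] M.a_inv_closed)
  also have "\<dots> = \<ominus> z"
    using assms M.l_neg M.l_zero M.a_inv_closed by metis
  finally show ?thesis unfolding M.minus_eq .
qed

lemma minus_eq_zero_iff:
  assumes "x \<in> carrier H" "y \<in> carrier H"
  shows "x \<ominus> y = \<zero> \<longleftrightarrow> x = y"
proof
  assume "x \<ominus> y = \<zero>"
  then have "x = \<ominus> (\<ominus> y)"
    using M.minus_equality[of x "\<ominus> y"] assms by (simp only: M.minus_eq M.a_inv_closed)
  then show "x = y" using assms by (simp only: M.minus_minus)
next
  assume "x = y"
  then show "x \<ominus> y = \<zero>" using assms M.r_neg by (simp only: M.minus_eq)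
qed

lemma hnorm_minus_commute:
  assumes "x \<in> carrier H" "y \<in> carrier H"
  shows "hnorm H (x \<ominus> y) = hnorm H (y \<ominus> x)"
proof -
  have "x \<ominus> y = \<ominus> (y \<ominus> x)"
    using minus_add_cancel[OF assms assms(1)] M.minus_equality M.minus_closed assms
    by (metis minus_eq_zero_iff)
  then have "x \<ominus> y = (-1) \<odot> (y \<ominus> x)"
    using smult_minus_one M.minus_closed assms by metis
  then show ?thesis
    using hnorm_smult[OF M.minus_closed[OF assms(2,1)], of "-1"] by simp
qed

lemma Metric_space_hdist: "Metric_space (carrier H) (hdist H)"
proof
  fix x y
  show "0 \<le> hdist H x y"
    unfolding hdist_def using hnorm_nonneg M.minus_closed by auto
  show "hdist H x y = hdist H y x"
    unfolding hdist_def using hnorm_minus_commute by auto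
next
  fix x y assume xy: "x \<in> carrier H" "y \<in> carrier H"
  then have "hdist H x y = hnorm H (x \<ominus> y)" by (simp only: hdist_def simp_thms if_True)
  then show "hdist H x y = 0 \<longleftrightarrow> x = y"
    using hnorm_eq_zero M.minus_closed minus_eq_zero_iff xy by metis
next
  fix x y z assume xyz: "x \<in> carrier H" "y \<in> carrier H" "z \<in> carrier H"
  have "hnorm H (x \<ominus> z) \<le> hnorm H (x \<ominus> y) + hnorm H (y \<ominus> z)"
    using hnorm_triangle[of "x \<ominus> y" "y \<ominus> z"] minus_add_cancel[OF xyz] M.minus_closed xyz
    by metis
  then show "hdist H x z \<le> hdist H x y + hdist H y z"
    using xyz by (simp only: hdist_def simp_thms if_True)
qed

end

section \<open>Unbounded operators\<close>

record 'a unbounded_op =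
  op_dom :: "'a set"
  op_fun :: "'a \<Rightarrow> 'a"

definition linear_op :: "('a, 'm) cinner_space_scheme \<Rightarrow> 'a unbounded_op \<Rightarrow> bool" where
  "linear_op H A \<longleftrightarrow>
     submodule (op_dom A) complex_ring H \<and>
     op_fun A ` op_dom A \<subseteq> carrier H \<and>
     (\<forall>x\<in>op_dom A. \<forall>y\<in>op_dom A. op_fun A (x \<oplus>\<^bsub>H\<^esub> y) = op_fun A x \<oplus>\<^bsub>H\<^esub> op_fun A y) \<and>
     (\<forall>c. \<forall>x\<in>op_dom A. op_fun A (c \<odot>\<^bsub>H\<^esub> x) = c \<odot>\<^bsub>H\<^esub> op_fun A x)"

text \<open>Values of \<^const>\<open>op_fun\<close> outside of the domain carry no information.\<close>

definition op_eq :: "'a unbounded_op \<Rightarrow> 'a unbounded_op \<Rightarrow> bool" where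
  "op_eq A B \<longleftrightarrow> op_dom A = op_dom B \<and> (\<forall>x\<in>op_dom A. op_fun A x = op_fun B x)"

definition op_comp :: "'a unbounded_op \<Rightarrow> 'a unbounded_op \<Rightarrow> 'a unbounded_op" where
  "op_comp A B =
     \<lparr>op_dom = {x \<in> op_dom B. op_fun B x \<in> op_dom A}, op_fun = (\<lambda>x. op_fun A (op_fun B x))\<rparr>"

definition one_to_one :: "'a unbounded_op \<Rightarrow> bool" where
  "one_to_one A \<longleftrightarrow> inj_on (op_fun A) (op_dom A)"

definition densely_defined ::
    "('a, 'm) cinner_space_scheme \<Rightarrow> 'a unbounded_op \<Rightarrow> bool" where
  "densely_defined H A \<longleftrightarrow>
     Metric_space.mtopology (carrier H) (hdist H) closure_of op_dom A = carrier H"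

definition op_graph :: "'a unbounded_op \<Rightarrow> ('a \<times> 'a) set" where
  "op_graph A = {(x, op_fun A x) |x. x \<in> op_dom A}"

text \<open>\<^const>\<open>prod_dist\<close> is the distance of the Hilbert space direct sum \<open>H \<oplus> H\<close>.\<close>

definition closed_op :: "('a, 'm) cinner_space_scheme \<Rightarrow> 'a unbounded_op \<Rightarrow> bool" where
  "closed_op H A \<longleftrightarrow>
     closedin (Metric_space.mtopology (carrier H \<times> carrier H) (prod_dist (hdist H) (hdist H)))
       (op_graph A)"

text \<open>The vector chosen by \<^const>\<open>The\<close> is unique when \<open>A\<close> is densely defined.\<close>

definition op_adjoint ::
    "('a, 'm) cinner_space_scheme \<Rightarrow> 'a unbounded_op \<Rightarrow> 'a unbounded_op" where
  "op_adjoint H A =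
     \<lparr>op_dom = {y \<in> carrier H.
        \<exists>z\<in>carrier H. \<forall>x\<in>op_dom A. cinner H (op_fun A x) y = cinner H x z},
      op_fun = (\<lambda>y. THE z.
        z \<in> carrier H \<and> (\<forall>x\<in>op_dom A. cinner H (op_fun A x) y = cinner H x z))\<rparr>"

definition paranormal :: "('a, 'm) cinner_space_scheme \<Rightarrow> 'a unbounded_op \<Rightarrow> bool" where
  "paranormal H A \<longleftrightarrow>
     linear_op H A \<and>
     (\<forall>x\<in>op_dom (op_comp A A).
        (hnorm H (op_fun A x))\<^sup>2 \<le> hnorm H (op_fun (op_comp A A) x) * hnorm H x)"

definition normal_op :: "('a, 'm) cinner_space_scheme \<Rightarrow> 'a unbounded_op \<Rightarrow> bool" where
  "normal_op H A \<longleftrightarrow>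
     linear_op H A \<and> densely_defined H A \<and> closed_op H A \<and>
     op_eq (op_comp A (op_adjoint H A)) (op_comp (op_adjoint H A) A)"

end

theory Submission
  imports Defs
begin

text \<open>
  If \<open>T\<^sup>2\<close> has domain \<open>{0}\<close>, then \<open>T\<close> is trivially paranormal, and also one-to-one because its
  kernel lies in the domain of \<open>T\<^sup>2\<close>. Such a \<open>T\<close>, with the same property for \<open>T\<^sup>*\<close>, comes from three
  bounded operators \<open>V\<close>, \<open>C\<close>, \<open>E\<close> on \<open>\<ell>\<^sup>2\<close> for which \<open>C a + E b = V c\<close> forces \<open>a = b = c = 0\<close>: put
  \<open>T (V a, b) = (C a + E b, a)\<close> on \<open>\<ell>\<^sup>2 \<oplus> \<ell>\<^sup>2\<close>. When \<open>V\<close>, \<open>C\<close>, \<open>E\<close> are self-adjoint, the adjoint is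
  \<open>T\<^sup>* (u, V v - C u) = (v, E u)\<close>. Take \<open>V\<close> diagonal with rapidly decaying entries and let
  \<open>C a\<close> and \<open>E b\<close> consist of the values at \<open>4\<^sup>-\<^sup>n\<close> of power series with coefficients built from \<open>a\<close>
  and \<open>b\<close>, in even and odd degrees; a power series whose values at these points decay faster
  than every power of \<open>4\<^sup>-\<^sup>n\<close> is zero.
\<close>

section \<open>Square-summable sequences\<close>

definition l2 :: "(nat \<Rightarrow> complex) set" where
  "l2 = {f. summable (\<lambda>n. (cmod (f n))\<^sup>2)}"

definition l2_inner :: "(nat \<Rightarrow> complex) \<Rightarrow> (nat \<Rightarrow> complex) \<Rightarrow> complex" where
  "l2_inner f g = (\<Sum>n. f n * cnj (g n))"

definition l2_sq :: "(nat \<Rightarrow> complex) \<Rightarrow> real" where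
  "l2_sq f = (\<Sum>n. (cmod (f n))\<^sup>2)"

definition unit_seq :: "nat \<Rightarrow> nat \<Rightarrow> complex" where
  "unit_seq j = (\<lambda>n. if n = j then 1 else 0)"

lemma l2D: "f \<in> l2 \<Longrightarrow> summable (\<lambda>n. (cmod (f n))\<^sup>2)"
  by (simp add: l2_def)

lemma l2_add:
  assumes "f \<in> l2" "g \<in> l2"
  shows "(\<lambda>n. f n + g n) \<in> l2"
proof -
  have "(cmod (f n + g n))\<^sup>2 \<le> 2 * (cmod (f n))\<^sup>2 + 2 * (cmod (g n))\<^sup>2" for n
  proof -
    have "(cmod (f n + g n))\<^sup>2 \<le> (cmod (f n) + cmod (g n))\<^sup>2"
      by (intro power_mono norm_triangle_ineq) simp
    also have "\<dots> \<le> 2 * (cmod (f n))\<^sup>2 + 2 * (cmod (g n))\<^sup>2"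
      using zero_le_power2[of "cmod (f n) - cmod (g n)"]
      by (simp add: power2_sum power2_diff)
    finally show ?thesis .
  qed
  moreover have "summable (\<lambda>n. 2 * (cmod (f n))\<^sup>2 + 2 * (cmod (g n))\<^sup>2)"
    using assms by (intro summable_add summable_mult l2D)
  ultimately show ?thesis
    unfolding l2_def mem_Collect_eq by - (rule summable_comparison_test', assumption, simp)
qed

lemma l2_smult: "f \<in> l2 \<Longrightarrow> (\<lambda>n. c * f n) \<in> l2"
  by (simp add: l2_def norm_mult power_mult_distrib summable_mult)

lemma l2_diff: "f \<in> l2 \<Longrightarrow> g \<in> l2 \<Longrightarrow> (\<lambda>n. f n - g n) \<in> l2"
  using l2_add[of f "\<lambda>n. (-1) * g n"] l2_smult[of g "-1"] by simp

lemma l2_zero [simp]: "(\<lambda>n. 0) \<in> l2"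
  by (simp add: l2_def)

lemma l2_finite_support:
  assumes "finite {n. f n \<noteq> 0}"
  shows "f \<in> l2"
proof -
  have "summable (\<lambda>n. (cmod (f n))\<^sup>2)"
    by (rule summable_finite[OF assms]) auto
  then show ?thesis by (simp add: l2_def)
qed

lemma unit_seq_l2 [simp]: "unit_seq j \<in> l2"
  by (rule l2_finite_support) (simp add: unit_seq_def)

text \<open>The squares are dominated by a geometric series of ratio 1/4. This is how the images of
  \<open>kern r\<close> are placed in \<open>l2\<close>.\<close>

lemma l2_geometric:
  assumes "\<And>n. cmod (f n) \<le> B * (1/2) ^ n"
  shows "f \<in> l2"
proof -
  have "(cmod (f n))\<^sup>2 \<le> B\<^sup>2 * (1/4) ^ n" for n
  proof -
    have "(cmod (f n))\<^sup>2 \<le> (B * (1/2) ^ n)\<^sup>2"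
      by (intro power_mono assms) simp
    also have "\<dots> = B\<^sup>2 * (1/4) ^ n"
      by (simp add: power_mult_distrib power2_eq_square flip: power_mult_distrib)
    finally show ?thesis .
  qed
  moreover have "summable (\<lambda>n. B\<^sup>2 * (1/4::real) ^ n)"
    by (intro summable_mult summable_geometric) simp
  ultimately show ?thesis
    unfolding l2_def mem_Collect_eq by - (rule summable_comparison_test', assumption, simp)
qed

lemma l2_inner_summable:
  assumes "f \<in> l2" "g \<in> l2"
  shows "summable (\<lambda>n. f n * cnj (g n))"
proof (rule summable_comparison_test')
  show "summable (\<lambda>n. (cmod (f n))\<^sup>2 + (cmod (g n))\<^sup>2)"
    using assms by (intro summable_add l2D)
  show "cmod (f n * cnj (g n)) \<le> (cmod (f n))\<^sup>2 + (cmod (g n))\<^sup>2" for n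
    using zero_le_power2[of "cmod (f n) - cmod (g n)"]
      mult_nonneg_nonneg[OF norm_ge_zero norm_ge_zero, of "f n" "g n"]
    unfolding norm_mult power2_diff complex_mod_cnj real_norm_def by linarith
qed

lemma l2_inner_add_left:
  "\<lbrakk>f \<in> l2; g \<in> l2; h \<in> l2\<rbrakk>
    \<Longrightarrow> l2_inner (\<lambda>n. f n + g n) h = l2_inner f h + l2_inner g h"
  using suminf_add[OF l2_inner_summable[of f h] l2_inner_summable[of g h]]
  by (simp add: l2_inner_def algebra_simps)

lemma l2_inner_smult_left:
  "\<lbrakk>f \<in> l2; g \<in> l2\<rbrakk> \<Longrightarrow> l2_inner (\<lambda>n. c * f n) g = c * l2_inner f g"
  using suminf_mult[OF l2_inner_summable[of f g], of c]
  by (simp add: l2_inner_def mult.assoc)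

lemma l2_inner_commute:
  assumes "f \<in> l2" "g \<in> l2"
  shows "l2_inner g f = cnj (l2_inner f g)"
proof -
  have "(\<lambda>n. f n * cnj (g n)) sums l2_inner f g"
    unfolding l2_inner_def by (rule summable_sums[OF l2_inner_summable[OF assms]])
  then have "(\<lambda>n. cnj (f n * cnj (g n))) sums cnj (l2_inner f g)"
    by (simp only: sums_cnj)
  then show ?thesis
    by (simp add: l2_inner_def sums_iff mult.commute)
qed

lemma l2_inner_self:
  assumes "f \<in> l2"
  shows "l2_inner f f = of_real (l2_sq f)"
proof -
  have "l2_inner f f = (\<Sum>n. of_real ((cmod (f n))\<^sup>2))"
    by (simp only: l2_inner_def complex_norm_square)
  then show ?thesis
    using suminf_of_real[OF l2D[OF assms], where 'a = complex] by (simp add: l2_sq_def)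
qed

lemma l2_inner_unit_right: "l2_inner f (unit_seq j) = f j"
proof -
  have "l2_inner f (unit_seq j) = (\<Sum>n\<in>{j}. f n * cnj (unit_seq j n))"
    unfolding l2_inner_def by (rule suminf_finite) (auto simp: unit_seq_def)
  then show ?thesis by (simp add: unit_seq_def)
qed

lemma l2_inner_unit_left: "l2_inner (unit_seq j) f = cnj (f j)"
proof -
  have "l2_inner (unit_seq j) f = (\<Sum>n\<in>{j}. unit_seq j n * cnj (f n))"
    unfolding l2_inner_def by (rule suminf_finite) (auto simp: unit_seq_def)
  then show ?thesis by (simp add: unit_seq_def)
qed

lemma l2_inner_zero [simp]: "l2_inner (\<lambda>n. 0) f = 0" "l2_inner f (\<lambda>n. 0) = 0"
  by (simp_all add: l2_inner_def)

lemma l2_sq_nonneg: "f \<in> l2 \<Longrightarrow> 0 \<le> l2_sq f"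
  unfolding l2_sq_def by (intro suminf_nonneg l2D) simp_all

lemma sum_le_l2_sq: "f \<in> l2 \<Longrightarrow> (\<Sum>n<m. (cmod (f n))\<^sup>2) \<le> l2_sq f"
  unfolding l2_sq_def by (intro sum_le_suminf l2D) simp_all

lemma coord_le_l2_sq: "f \<in> l2 \<Longrightarrow> (cmod (f n))\<^sup>2 \<le> l2_sq f"
  unfolding l2_sq_def
  using sum_le_suminf[OF l2D[of f], of "{n}"] by simp

lemma l2_bounded: "f \<in> l2 \<Longrightarrow> cmod (f n) \<le> sqrt (l2_sq f)"
  using coord_le_l2_sq[of f n] real_le_rsqrt by blast

text \<open>Dropping the nonnegative terms of one sequence bounds the partial sums of the other. The
  hypothesis speaks of finite sums because these pass directly to coordinatewise limits in the
  completeness proof.\<close>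

lemma l2_sum_bound:
  assumes "\<And>m. (\<Sum>n<m. (cmod (f n))\<^sup>2 + (cmod (g n))\<^sup>2) \<le> B"
  shows "f \<in> l2" "g \<in> l2" "l2_sq f + l2_sq g \<le> B"
proof -
  have "summable (\<lambda>n. (cmod (f n))\<^sup>2)"
  proof (rule summableI_nonneg_bounded)
    show "(\<Sum>n<m. (cmod (f n))\<^sup>2) \<le> B" for m
      using assms[of m] sum_nonneg[of "{..<m}" "\<lambda>n. (cmod (g n))\<^sup>2"]
      by (simp add: sum.distrib)
  qed simp
  moreover have "summable (\<lambda>n. (cmod (g n))\<^sup>2)"
  proof (rule summableI_nonneg_bounded)
    show "(\<Sum>n<m. (cmod (g n))\<^sup>2) \<le> B" for m
      using assms[of m] sum_nonneg[of "{..<m}" "\<lambda>n. (cmod (f n))\<^sup>2"]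
      by (simp add: sum.distrib)
  qed simp
  ultimately show "f \<in> l2" "g \<in> l2" and "l2_sq f + l2_sq g \<le> B"
    using suminf_le_const[OF summable_add assms] by (simp_all add: l2_def l2_sq_def suminf_add)
qed


section \<open>The Hilbert space\<close>

text \<open>The sum of two copies of \<open>l2\<close>: the integer \<open>n \<ge> 0\<close> carries the \<open>n\<close>-th coordinate of
  the first summand, and \<open>- 1 - n\<close> that of the second.\<close>

definition first :: "(real \<Rightarrow> complex) \<Rightarrow> nat \<Rightarrow> complex" where
  "first h n = h (real n)"

definition second :: "(real \<Rightarrow> complex) \<Rightarrow> nat \<Rightarrow> complex" where
  "second h n = h (- 1 - real n)"

definition glue :: "(nat \<Rightarrow> complex) \<Rightarrow> (nat \<Rightarrow> complex) \<Rightarrow> real \<Rightarrow> complex" where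
  "glue f g t =
     (if t \<in> \<int> then if t \<ge> 0 then f (nat \<lfloor>t\<rfloor>) else g (nat (- 1 - \<lfloor>t\<rfloor>)) else 0)"

text \<open>The vector type is \<open>real => complex\<close>, so a sequence indexed by the integers
  is stored as a function that vanishes off the integers. A vector is then determined by its two
  halves.\<close>

definition L2 :: "(real \<Rightarrow> complex) cinner_space" where
  "L2 = \<lparr>carrier = {h. (\<forall>t. t \<notin> \<int> \<longrightarrow> h t = 0) \<and> first h \<in> l2 \<and> second h \<in> l2},
     mult = undefined, one = undefined,
     zero = (\<lambda>t. 0), add = (\<lambda>h k t. h t + k t), smult = (\<lambda>a h t. a * h t),
     cinner = (\<lambda>h k. l2_inner (first h) (first k) + l2_inner (second h) (second k))\<rparr>"

lemma first_glue [simp]: "first (glue f g) = f"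
  by (simp add: fun_eq_iff first_def glue_def)

lemma second_glue [simp]: "second (glue f g) = g"
proof -
  have "- 1 - real n \<in> \<int>" "\<lfloor>- 1 - real n\<rfloor> = - 1 - int n" for n
    by (auto simp: floor_eq_iff)
  then show ?thesis by (simp add: fun_eq_iff second_def glue_def)
qed

lemma first_simps [simp]:
  "first (\<lambda>t. h t + k t) = (\<lambda>n. first h n + first k n)"
  "first (\<lambda>t. h t - k t) = (\<lambda>n. first h n - first k n)"
  "first (\<lambda>t. a * h t) = (\<lambda>n. a * first h n)"
  "first (\<lambda>t. 0) = (\<lambda>n. 0)"
  by (simp_all add: first_def fun_eq_iff)

lemma second_simps [simp]:
  "second (\<lambda>t. h t + k t) = (\<lambda>n. second h n + second k n)"
  "second (\<lambda>t. h t - k t) = (\<lambda>n. second h n - second k n)"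
  "second (\<lambda>t. a * h t) = (\<lambda>n. a * second h n)"
  "second (\<lambda>t. 0) = (\<lambda>n. 0)"
  by (simp_all add: second_def fun_eq_iff)

lemma L2_simps [simp]:
  "zero L2 = (\<lambda>t. 0)" "add L2 h k = (\<lambda>t. h t + k t)" "smult L2 a h = (\<lambda>t. a * h t)"
  "cinner L2 h k = l2_inner (first h) (first k) + l2_inner (second h) (second k)"
  by (simp_all add: L2_def)

lemma mem_L2:
  "h \<in> carrier L2 \<longleftrightarrow> (\<forall>t. t \<notin> \<int> \<longrightarrow> h t = 0) \<and> first h \<in> l2 \<and> second h \<in> l2"
  by (simp add: L2_def)

lemma glue_in_L2: "f \<in> l2 \<Longrightarrow> g \<in> l2 \<Longrightarrow> glue f g \<in> carrier L2"
  by (simp add: mem_L2) (simp add: glue_def)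

lemma int_coord_cases:
  assumes "t \<in> \<int>"
  obtains n where "t = real n" | n where "t = - 1 - real n"
proof -
  obtain i where i: "t = of_int i" using assms Ints_cases by blast
  show thesis
  proof (cases "i \<ge> 0")
    case True
    then show thesis using i that(1)[of "nat i"] by simp
  next
    case False
    then show thesis using i that(2)[of "nat (- 1 - i)"] by simp
  qed
qed

lemma L2_eqI:
  assumes "h \<in> carrier L2" "k \<in> carrier L2" "first h = first k" "second h = second k"
  shows "h = k"
proof
  fix t show "h t = k t"
  proof (cases "t \<in> \<int>")
    case True
    then show ?thesis
      using assms(3,4) by (cases rule: int_coord_cases) (auto simp: first_def second_def fun_eq_iff)
  next
    case False
    then show ?thesis using assms(1,2) by (simp add: mem_L2)
  qed
qed

lemma L2_add: "h \<in> carrier L2 \<Longrightarrow> k \<in> carrier L2 \<Longrightarrow> (\<lambda>t. h t + k t) \<in> carrier L2"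
  by (simp add: mem_L2 l2_add)

lemma L2_smult: "h \<in> carrier L2 \<Longrightarrow> (\<lambda>t. a * h t) \<in> carrier L2"
  by (simp add: mem_L2 l2_smult)

lemma L2_zero: "(\<lambda>t. 0) \<in> carrier L2"
  by (simp add: mem_L2)

lemma hnorm_L2: "h \<in> carrier L2 \<Longrightarrow> hnorm L2 h = sqrt (l2_sq (first h) + l2_sq (second h))"
  by (simp add: hnorm_def mem_L2 l2_inner_self)

text \<open>Point evaluations have norm at most 1. Hence norm convergence gives convergence of the
  coordinates, uniformly in \<open>t\<close>, which completeness and closedness rest on;
  definiteness of the inner product also follows.\<close>

lemma coord_le_hnorm:
  assumes h: "h \<in> carrier L2"
  shows "cmod (h t) \<le> hnorm L2 h"
proof (cases "t \<in> \<int>")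
  case True
  have l2: "first h \<in> l2" "second h \<in> l2" using h by (simp_all add: mem_L2)
  from True have "(cmod (h t))\<^sup>2 \<le> l2_sq (first h) + l2_sq (second h)"
  proof (cases rule: int_coord_cases)
    case (1 n)
    then show ?thesis
      using coord_le_l2_sq[OF l2(1), of n] l2_sq_nonneg[OF l2(2)] by (simp add: first_def)
  next
    case (2 n)
    then show ?thesis
      using coord_le_l2_sq[OF l2(2), of n] l2_sq_nonneg[OF l2(1)] by (simp add: second_def)
  qed
  then show ?thesis using hnorm_L2[OF h] real_le_rsqrt by simp
next
  case False
  then have "h t = 0" using h by (simp add: mem_L2)
  then show ?thesis
    using h by (simp add: hnorm_L2 mem_L2 l2_sq_nonneg)
qed

interpretation L2: complex_inner_product_space L2
proof (intro complex_inner_product_space.intro complex_inner_product_space_axioms.intro)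
  show "module complex_ring L2"
  proof (intro moduleI abelian_groupI)
    show "cring (complex_ring :: complex ring)" by (rule cring_from_type_algebra)
  next
    fix h assume h: "h \<in> carrier L2"
    show "\<exists>k\<in>carrier L2. k \<oplus>\<^bsub>L2\<^esub> h = \<zero>\<^bsub>L2\<^esub>"
      by (rule bexI[of _ "\<lambda>t. (-1) * h t"]) (use L2_smult[OF h, of "-1"] in simp_all)
  qed (auto simp: ring_of_type_algebra_def algebra_simps intro: L2_add L2_smult L2_zero)
next
  fix h k assume "h \<in> carrier L2" "k \<in> carrier L2"
  then show "cinner L2 k h = cnj (cinner L2 h k)"
    using l2_inner_commute[of "first h" "first k"] l2_inner_commute[of "second h" "second k"]
    by (simp add: mem_L2)
next
  fix h assume h: "h \<in> carrier L2" and 0: "cinner L2 h h = 0"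
  then have "l2_sq (first h) + l2_sq (second h) = 0"
    by (simp add: mem_L2 l2_inner_self flip: of_real_add)
  then have "h t = 0" for t using coord_le_hnorm[OF h, of t] hnorm_L2[OF h] by simp
  then show "h = \<zero>\<^bsub>L2\<^esub>" by auto
qed (auto simp: mem_L2 l2_inner_add_left l2_inner_smult_left l2_inner_self l2_sq_nonneg
      distrib_left)

interpretation L2: Metric_space "carrier L2" "hdist L2"
  by (rule L2.Metric_space_hdist)

lemma L2_diff:
  assumes "h \<in> carrier L2" "k \<in> carrier L2"
  shows "(\<lambda>t. h t - k t) \<in> carrier L2"
  using L2_add[OF assms(1) L2_smult[OF assms(2), of "-1"]] by simp

lemma L2_minus:
  assumes "h \<in> carrier L2" "k \<in> carrier L2"
  shows "h \<ominus>\<^bsub>L2\<^esub> k = (\<lambda>t. h t - k t)"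
  using L2.smult_minus_one[OF assms(2)] by (simp add: a_minus_def)

lemma hdist_L2:
  assumes "h \<in> carrier L2" "k \<in> carrier L2"
  shows "hdist L2 h k
    = sqrt (l2_sq (\<lambda>n. first h n - first k n) + l2_sq (\<lambda>n. second h n - second k n))"
  using hnorm_L2[OF L2_diff[OF assms]] assms by (simp add: hdist_def L2_minus)

lemma coord_diff_le_hdist:
  assumes "h \<in> carrier L2" "k \<in> carrier L2"
  shows "cmod (h t - k t) \<le> hdist L2 h k"
  using coord_le_hnorm[OF L2_diff[OF assms], of t] assms by (simp add: hdist_def L2_minus)

text \<open>A Cauchy sequence converges in every coordinate. The Cauchy estimate, restricted to
  finitely many coordinates, survives this limit and bounds the distance to the coordinatewise limit
  \<open>h\<close>.\<close>

interpretation L2: complex_hilbert_space L2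
proof unfold_locales
  show "L2.mcomplete"
    unfolding L2.mcomplete_def
  proof (intro allI impI)
    fix \<sigma> assume "L2.MCauchy \<sigma>"
    then have \<sigma>: "\<And>i. \<sigma> i \<in> carrier L2"
      and Cau: "\<And>e. e > 0 \<Longrightarrow> \<exists>N. \<forall>i j. N \<le> i \<longrightarrow> N \<le> j \<longrightarrow> hdist L2 (\<sigma> i) (\<sigma> j) < e"
      by (auto simp: L2.MCauchy_def)
    have "Cauchy (\<lambda>i. \<sigma> i t)" for t
    proof (rule CauchyI)
      fix e :: real assume "e > 0"
      then obtain N where "\<forall>i j. N \<le> i \<longrightarrow> N \<le> j \<longrightarrow> hdist L2 (\<sigma> i) (\<sigma> j) < e"
        using Cau by blast
      then show "\<exists>M. \<forall>m\<ge>M. \<forall>n\<ge>M. cmod (\<sigma> m t - \<sigma> n t) < e"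
        using coord_diff_le_hdist[OF \<sigma> \<sigma>] by (meson order_le_less_trans)
    qed
    then have "convergent (\<lambda>i. \<sigma> i t)" for t
      by (rule Cauchy_convergent)
    then have lim: "(\<lambda>i. \<sigma> i t) \<longlonglongrightarrow> lim (\<lambda>i. \<sigma> i t)" for t
      by (simp only: convergent_LIMSEQ_iff)
    define h where "h = (\<lambda>t. lim (\<lambda>i. \<sigma> i t))"
    have h: "(\<lambda>i. \<sigma> i t) \<longlonglongrightarrow> h t" for t
      unfolding h_def by (rule lim)
    have supp: "h t = 0" if "t \<notin> \<int>" for t
      using h[of t] \<sigma> that by (simp add: mem_L2 LIMSEQ_const_iff)
    have near: "\<exists>N. \<forall>i\<ge>N. (\<lambda>n. first (\<sigma> i) n - first h n) \<in> l2 \<and>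
        (\<lambda>n. second (\<sigma> i) n - second h n) \<in> l2 \<and>
        l2_sq (\<lambda>n. first (\<sigma> i) n - first h n) + l2_sq (\<lambda>n. second (\<sigma> i) n - second h n) \<le> e\<^sup>2"
      if e: "e > 0" for e
    proof -
      obtain N where N: "\<And>i j. N \<le> i \<Longrightarrow> N \<le> j \<Longrightarrow> hdist L2 (\<sigma> i) (\<sigma> j) < e"
        using Cau[OF e] by blast
      \<comment> \<open>Fix \<open>i\<close> and let \<open>j\<close> tend to infinity: a sum over
        \<open>n < m\<close> converges, and the bound does not depend on \<open>m\<close>.\<close>
      have bd: "(\<Sum>n<m. (cmod (first (\<sigma> i) n - first h n))\<^sup>2
          + (cmod (second (\<sigma> i) n - second h n))\<^sup>2) \<le> e\<^sup>2" if i: "N \<le> i" for i m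
      proof (rule LIMSEQ_le_const2)
        show "(\<lambda>j. \<Sum>n<m. (cmod (first (\<sigma> i) n - first (\<sigma> j) n))\<^sup>2
            + (cmod (second (\<sigma> i) n - second (\<sigma> j) n))\<^sup>2) \<longlonglongrightarrow>
          (\<Sum>n<m. (cmod (first (\<sigma> i) n - first h n))\<^sup>2
            + (cmod (second (\<sigma> i) n - second h n))\<^sup>2)"
          unfolding first_def second_def by (intro tendsto_intros h)
        have "(\<Sum>n<m. (cmod (first (\<sigma> i) n - first (\<sigma> j) n))\<^sup>2
            + (cmod (second (\<sigma> i) n - second (\<sigma> j) n))\<^sup>2) \<le> e\<^sup>2" if j: "N \<le> j" for j
        proof -
          let ?d = "\<lambda>t. \<sigma> i t - \<sigma> j t"
          have d: "first ?d \<in> l2" "second ?d \<in> l2"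
            using L2_diff[OF \<sigma> \<sigma>, of i j] by (simp_all only: mem_L2)
          have "l2_sq (first ?d) + l2_sq (second ?d) = (hdist L2 (\<sigma> i) (\<sigma> j))\<^sup>2"
            using l2_sq_nonneg[OF d(1)] l2_sq_nonneg[OF d(2)] hdist_L2[OF \<sigma> \<sigma>, of i j] by simp
          also have "\<dots> \<le> e\<^sup>2"
            using N[OF i j] by (intro power_mono) auto
          finally show ?thesis
            using sum_le_l2_sq[OF d(1), of m] sum_le_l2_sq[OF d(2), of m] by (simp add: sum.distrib)
        qed
        then show "\<exists>M. \<forall>j\<ge>M. (\<Sum>n<m. (cmod (first (\<sigma> i) n - first (\<sigma> j) n))\<^sup>2
            + (cmod (second (\<sigma> i) n - second (\<sigma> j) n))\<^sup>2) \<le> e\<^sup>2" by blast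
      qed
      show ?thesis using l2_sum_bound[OF bd] by blast
    qed
    obtain i where "(\<lambda>n. first (\<sigma> i) n - first h n) \<in> l2" "(\<lambda>n. second (\<sigma> i) n - second h n) \<in> l2"
      using near[of 1] by auto
    \<comment> \<open>\<open>h\<close> is \<open>\<sigma> i\<close> minus the square-summable
      difference \<open>\<sigma> i - h\<close>.\<close>
    then have hL2: "h \<in> carrier L2"
      using \<sigma>[of i] l2_diff[of "first (\<sigma> i)" "\<lambda>n. first (\<sigma> i) n - first h n"]
        l2_diff[of "second (\<sigma> i)" "\<lambda>n. second (\<sigma> i) n - second h n"] supp
      by (simp add: mem_L2)
    have "limitin L2.mtopology \<sigma> h sequentially"
      unfolding L2.limit_metric_sequentially
    proof (intro conjI allI impI hL2)
      fix e :: real assume e: "e > 0"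
      \<comment> \<open>The bound from \<open>near\<close> is not strict, hence the radius
        \<open>e/2\<close>.\<close>
      then obtain N where N: "\<forall>i\<ge>N. l2_sq (\<lambda>n. first (\<sigma> i) n - first h n)
          + l2_sq (\<lambda>n. second (\<sigma> i) n - second h n) \<le> (e/2)\<^sup>2"
        using near[of "e/2"] by auto
      have "hdist L2 (\<sigma> i) h < e" if "i \<ge> N" for i
      proof -
        have "hdist L2 (\<sigma> i) h \<le> e/2"
          unfolding hdist_L2[OF \<sigma> hL2] using N that e by (intro real_le_lsqrt) auto
        then show ?thesis using e by simp
      qed
      then show "\<exists>N. \<forall>n\<ge>N. \<sigma> n \<in> carrier L2 \<and> hdist L2 (\<sigma> n) h < e" using \<sigma> by blast
    qed
    then show "\<exists>x. limitin L2.mtopology \<sigma> x sequentially" by blast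
  qed
qed


section \<open>Operators with trivial square\<close>

context complex_inner_product_space
begin

lemma linear_opD:
  assumes "linear_op H A"
  shows "op_dom A \<subseteq> carrier H" "\<zero> \<in> op_dom A"
    and "x \<in> op_dom A \<Longrightarrow> op_fun A x \<in> carrier H"
    and "\<lbrakk>x \<in> op_dom A; y \<in> op_dom A\<rbrakk> \<Longrightarrow> x \<oplus> y \<in> op_dom A"
    and "x \<in> op_dom A \<Longrightarrow> c \<odot> x \<in> op_dom A"
    and "\<lbrakk>x \<in> op_dom A; y \<in> op_dom A\<rbrakk> \<Longrightarrow> op_fun A (x \<oplus> y) = op_fun A x \<oplus> op_fun A y"
    and "x \<in> op_dom A \<Longrightarrow> op_fun A (c \<odot> x) = c \<odot> op_fun A x"
proof -
  have sub: "submodule (op_dom A) complex_ring H"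
    using assms by (simp add: linear_op_def)
  show dom: "op_dom A \<subseteq> carrier H" by (rule submoduleE(1)[OF sub])
  show smult: "x \<in> op_dom A \<Longrightarrow> c \<odot> x \<in> op_dom A" for x c
    using submoduleE(4)[OF sub] by simp
  show "\<lbrakk>x \<in> op_dom A; y \<in> op_dom A\<rbrakk> \<Longrightarrow> x \<oplus> y \<in> op_dom A"
    by (rule submoduleE(5)[OF sub])
  obtain x where x: "x \<in> op_dom A" using submoduleE(2)[OF sub] by blast
  then show "\<zero> \<in> op_dom A" using smult[of x 0] dom smult_zero_left by auto
qed (use assms in \<open>auto simp: linear_op_def\<close>)

lemma linear_opI:
  assumes "op_dom A \<subseteq> carrier H" "\<zero> \<in> op_dom A"
    and "\<And>x. x \<in> op_dom A \<Longrightarrow> op_fun A x \<in> carrier H"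
    and "\<And>x y. \<lbrakk>x \<in> op_dom A; y \<in> op_dom A\<rbrakk>
      \<Longrightarrow> x \<oplus> y \<in> op_dom A \<and> op_fun A (x \<oplus> y) = op_fun A x \<oplus> op_fun A y"
    and "\<And>x c. x \<in> op_dom A \<Longrightarrow> c \<odot> x \<in> op_dom A \<and> op_fun A (c \<odot> x) = c \<odot> op_fun A x"
  shows "linear_op H A"
proof -
  have "submodule (op_dom A) complex_ring H"
  proof (rule submoduleI)
    show "\<ominus> a \<in> op_dom A" if "a \<in> op_dom A" for a
      using assms(1) assms(5)[OF that, of "-1"] that smult_minus_one by auto
  qed (use assms in auto)
  then show ?thesis using assms by (auto simp: linear_op_def)
qed

lemma linear_op_zero:
  assumes "linear_op H A"
  shows "op_fun A \<zero> = \<zero>"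
  using linear_opD(7)[OF assms linear_opD(2)[OF assms], of 0]
    linear_opD(2,3)[OF assms] smult_zero_left by simp

text \<open>The inequality of paranormality is imposed only on the domain of the square, here the
  zero vector, where both sides vanish. If \<open>x\<close> and \<open>y\<close> have the same
  image, their difference is sent to zero and so lies in that domain too.\<close>

lemma trivial_square:
  assumes lin: "linear_op H A"
    and triv: "\<And>x. \<lbrakk>x \<in> op_dom A; op_fun A x \<in> op_dom A\<rbrakk> \<Longrightarrow> x = \<zero>"
  shows "paranormal H A" "one_to_one A"
proof -
  have "hnorm H \<zero> = 0" using hnorm_eq_zero by simp
  then show "paranormal H A"
    unfolding paranormal_def op_comp_def
    using lin triv linear_op_zero[OF lin] by fastforce
  show "one_to_one A"
    unfolding one_to_one_def
  proof (rule inj_onI)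
    fix x y assume x: "x \<in> op_dom A" and y: "y \<in> op_dom A" and eq: "op_fun A x = op_fun A y"
    note D = linear_opD[OF lin]
    have minus: "u \<ominus> v = u \<oplus> (-1) \<odot> v" if "v \<in> carrier H" for u v
      using smult_minus_one[OF that] by (simp add: a_minus_def)
    have d: "x \<ominus> y \<in> op_dom A"
      using minus D(1) x y D(4)[OF x D(5)[OF y]] by auto
    have "op_fun A (x \<ominus> y) = op_fun A x \<ominus> op_fun A y"
      using minus D(1) x y D(3)[OF y] D(6)[OF x D(5)[OF y]] D(7)[OF y] by auto
    also have "\<dots> = \<zero>" using eq D(3) x y minus_eq_zero_iff by simp
    finally have "x \<ominus> y = \<zero>" using triv[OF d] D(2) by simp
    then show "x = y" using minus_eq_zero_iff D(1) x y by auto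
  qed
qed

text \<open>Density enters through \<open>sep\<close>, the triviality of the orthogonal complement
  of the domain, which can be checked on test vectors. It makes the vector chosen by
  \<open>THE\<close> unique: two candidates differ by a vector orthogonal to the domain.\<close>

lemma
  assumes lin: "linear_op H A"
    and sep: "\<forall>z\<in>carrier H. (\<forall>x\<in>op_dom A. cinner H x z = 0) \<longrightarrow> z = \<zero>"
  shows op_adjoint_eqI: "\<lbrakk>y \<in> carrier H; z \<in> carrier H;
        \<And>x. x \<in> op_dom A \<Longrightarrow> cinner H (op_fun A x) y = cinner H x z\<rbrakk>
      \<Longrightarrow> y \<in> op_dom (op_adjoint H A) \<and> op_fun (op_adjoint H A) y = z"
    and op_adjointD: "y \<in> op_dom (op_adjoint H A)
      \<Longrightarrow> y \<in> carrier H \<and> op_fun (op_adjoint H A) y \<in> carrier H \<and>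
        (\<forall>x\<in>op_dom A. cinner H (op_fun A x) y = cinner H x (op_fun (op_adjoint H A) y))"
    and linear_op_adjoint: "linear_op H (op_adjoint H A)"
proof -
  note D = linear_opD[OF lin]
  show eqI: "y \<in> op_dom (op_adjoint H A) \<and> op_fun (op_adjoint H A) y = z"
    if y: "y \<in> carrier H" and z: "z \<in> carrier H"
      and yz: "\<And>x. x \<in> op_dom A \<Longrightarrow> cinner H (op_fun A x) y = cinner H x z" for y z
  proof
    show "y \<in> op_dom (op_adjoint H A)" using y z yz by (auto simp: op_adjoint_def)
    have uniq: "z' = z" if z': "z' \<in> carrier H"
      and yz': "\<And>x. x \<in> op_dom A \<Longrightarrow> cinner H (op_fun A x) y = cinner H x z'" for z'
    proof -
      have "cinner H x (z' \<ominus> z) = 0" if "x \<in> op_dom A" for x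
      proof -
        have x: "x \<in> carrier H" using D(1) that by auto
        have "z' \<ominus> z = z' \<oplus> (-1) \<odot> z" using smult_minus_one[OF z] by (simp add: a_minus_def)
        then show ?thesis
          using cinner_add_right[OF z' smult_carrier[OF z, of "-1"] x]
            cinner_smult_right[OF z x, of "-1"] yz[OF that] yz'[OF that] by simp
      qed
      then have "z' \<ominus> z = \<zero>" using bspec[OF sep M.minus_closed[OF z' z]] by blast
      then show ?thesis using minus_eq_zero_iff z z' by simp
    qed
    have "(THE z. z \<in> carrier H \<and> (\<forall>x\<in>op_dom A. cinner H (op_fun A x) y = cinner H x z)) = z"
      by (rule the_equality) (use z yz in blast, use uniq in blast)
    then show "op_fun (op_adjoint H A) y = z"
      by (simp add: op_adjoint_def)
  qed
  show adjD: "y \<in> carrier H \<and> op_fun (op_adjoint H A) y \<in> carrier H \<and>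
      (\<forall>x\<in>op_dom A. cinner H (op_fun A x) y = cinner H x (op_fun (op_adjoint H A) y))"
    if "y \<in> op_dom (op_adjoint H A)" for y
  proof -
    obtain z where "y \<in> carrier H" "z \<in> carrier H"
        "\<And>x. x \<in> op_dom A \<Longrightarrow> cinner H (op_fun A x) y = cinner H x z"
      using \<open>y \<in> op_dom (op_adjoint H A)\<close> by (auto simp: op_adjoint_def)
    then show ?thesis using eqI[of y z] by auto
  qed
  have cinner_zero: "cinner H x \<zero> = 0" if "x \<in> carrier H" for x
    using cinner_smult_right[OF M.zero_closed that, of 0] smult_zero_left[OF M.zero_closed] by simp
  show "linear_op H (op_adjoint H A)"
  proof (rule linear_opI)
    show "\<zero> \<in> op_dom (op_adjoint H A)"
      using eqI[of \<zero> \<zero>] cinner_zero D(1,3) by auto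
  next
    fix y z assume y: "y \<in> op_dom (op_adjoint H A)" and z: "z \<in> op_dom (op_adjoint H A)"
    show "y \<oplus> z \<in> op_dom (op_adjoint H A) \<and>
      op_fun (op_adjoint H A) (y \<oplus> z) = op_fun (op_adjoint H A) y \<oplus> op_fun (op_adjoint H A) z"
      using adjD[OF y] adjD[OF z] D(1,3) by (intro eqI) (auto simp: cinner_add_right)
  next
    fix y c assume y: "y \<in> op_dom (op_adjoint H A)"
    show "c \<odot> y \<in> op_dom (op_adjoint H A) \<and>
      op_fun (op_adjoint H A) (c \<odot> y) = c \<odot> op_fun (op_adjoint H A) y"
      using adjD[OF y] D(1,3) smult_carrier
      by (intro eqI) (auto simp: cinner_smult_right)
  qed (use adjD in auto)
qed

end


section \<open>Operators with independent ranges\<close>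

text \<open>The ranges of \<open>kern 1\<close> and \<open>kern 2\<close> consist of the values at the points \<open>4\<^sup>-\<^sup>n\<close> of odd and of
  even power series, whereas the sequences \<open>weight n * f n\<close> decay faster than all powers
  of \<open>4\<^sup>-\<^sup>n\<close>.\<close>

definition kern :: "nat \<Rightarrow> (nat \<Rightarrow> complex) \<Rightarrow> nat \<Rightarrow> complex" where
  "kern r f n = (\<Sum>k. (1/2) ^ ((2 * n + r) * (2 * k + r)) * f k)"

definition weight :: "nat \<Rightarrow> complex" where
  "weight n = (1/4) ^ (n * n)"

lemma weight_nonzero [simp]: "weight n \<noteq> 0"
  by (simp add: weight_def)

lemma weight_0 [simp]: "weight 0 = 1"
  by (simp add: weight_def)

lemma cnj_weight [simp]: "cnj (weight n) = weight n"
  by (simp add: weight_def)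

lemma cmod_weight: "cmod (weight n) = (1/4) ^ (n * n)"
  by (simp add: weight_def norm_power)

text \<open>The exponent is at least \<open>(2 * n + 1) * (2 * k + 1)\<close>, hence at least
  \<open>n + Suc k\<close>. The matrix entries thus decay geometrically in both indices, and the
  factors \<open>(1/2) ^ Suc k\<close> sum to 1.\<close>

lemma kern_bounded:
  assumes r: "r > 0" and B: "\<And>k. cmod (f k) \<le> B"
  shows kern_summable: "summable (\<lambda>k. (1/2) ^ ((2 * n + r) * (2 * k + r)) * f k)"
    and kern_le: "cmod (kern r f n) \<le> B * (1/2) ^ n"
proof -
  have half: "(\<lambda>k. (1/2::real) ^ Suc k) sums 1" by (rule power_half_series)
  have le: "cmod ((1/2) ^ ((2 * n + r) * (2 * k + r)) * f k) \<le> B * (1/2) ^ n * (1/2) ^ Suc k" for k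
  proof -
    have "(2 * n + 1) * (2 * k + 1) \<le> (2 * n + r) * (2 * k + r)"
      using r by (intro mult_mono) auto
    then have "n + Suc k \<le> (2 * n + r) * (2 * k + r)" by (simp add: algebra_simps)
    then have "(1/2::real) ^ ((2 * n + r) * (2 * k + r)) \<le> (1/2) ^ (n + Suc k)"
      by (intro power_decreasing) auto
    then have "(1/2::real) ^ ((2 * n + r) * (2 * k + r)) * cmod (f k) \<le> (1/2) ^ (n + Suc k) * B"
      by (intro mult_mono B) auto
    then show ?thesis by (simp add: norm_mult norm_power power_add mult_ac)
  qed
  have sums: "(\<lambda>k. B * (1/2) ^ n * (1/2) ^ Suc k) sums (B * (1/2) ^ n * 1)"
    by (intro sums_mult half)
  show "summable (\<lambda>k. (1/2) ^ ((2 * n + r) * (2 * k + r)) * f k)"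
    by (rule summable_comparison_test'[OF sums_summable[OF sums]]) (rule le)
  show "cmod (kern r f n) \<le> B * (1/2) ^ n"
    unfolding kern_def
    using norm_suminf_le[OF le sums_summable[OF sums]] sums_unique[OF sums] by simp
qed

lemma kern_l2: "r > 0 \<Longrightarrow> f \<in> l2 \<Longrightarrow> kern r f \<in> l2"
  by (rule l2_geometric) (rule kern_le[OF _ l2_bounded])

lemma kern_add:
  assumes "r > 0" "f \<in> l2" "g \<in> l2"
  shows "kern r (\<lambda>k. f k + g k) n = kern r f n + kern r g n"
  using suminf_add[OF kern_summable[OF assms(1) l2_bounded[OF assms(2)], of n]
      kern_summable[OF assms(1) l2_bounded[OF assms(3)], of n]]
  by (simp add: kern_def distrib_left)

lemma kern_smult:
  assumes "r > 0" "f \<in> l2"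
  shows "kern r (\<lambda>k. c * f k) n = c * kern r f n"
  using suminf_mult[OF kern_summable[OF assms(1) l2_bounded[OF assms(2)], of n], of c]
  by (simp add: kern_def mult_ac)

lemma kern_zero [simp]: "kern r (\<lambda>k. 0) n = 0"
  by (simp add: kern_def)

text \<open>The matrix of \<open>kern r\<close> is real and symmetric. This is its self-adjointness,
  tested on basis sequences, the form in which the adjoint of \<open>T_op\<close> is
  computed.\<close>

lemma l2_inner_kern_unit:
  assumes "r > 0" "g \<in> l2"
  shows "l2_inner (kern r (unit_seq j)) g = cnj (kern r g j)"
proof -
  have "kern r (unit_seq j) n = (1/2) ^ ((2 * n + r) * (2 * j + r))" for n
  proof -
    have "kern r (unit_seq j) n
      = (\<Sum>k\<in>{j}. (1/2) ^ ((2 * n + r) * (2 * k + r)) * unit_seq j k)"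
      unfolding kern_def by (rule suminf_finite) (auto simp: unit_seq_def)
    then show ?thesis by (simp add: unit_seq_def)
  qed
  then have "l2_inner (kern r (unit_seq j)) g
    = (\<Sum>n. cnj ((1/2) ^ ((2 * j + r) * (2 * n + r)) * g n))"
    by (simp add: l2_inner_def mult.commute)
  moreover have "(\<lambda>n. cnj ((1/2) ^ ((2 * j + r) * (2 * n + r)) * g n)) sums cnj (kern r g j)"
    unfolding sums_cnj kern_def
    by (rule summable_sums[OF kern_summable[OF assms(1) l2_bounded[OF assms(2)]]])
  ultimately show ?thesis by (simp add: sums_iff)
qed

section \<open>Power series that decay too fast to be nonzero\<close>

lemma sums_if_complex:
  fixes f g :: "nat \<Rightarrow> complex"
  assumes "f sums x" "g sums y"
  shows "(\<lambda>n. if even n then f (n div 2) else g ((n - 1) div 2)) sums (x + y)"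
proof -
  have "(\<lambda>n. if even n then Re (f (n div 2)) else Re (g ((n - 1) div 2))) sums (Re y + Re x)"
    "(\<lambda>n. if even n then Im (f (n div 2)) else Im (g ((n - 1) div 2))) sums (Im y + Im x)"
    using assms sums_if[of "\<lambda>n. Re (g n)" "Re y" "\<lambda>n. Re (f n)" "Re x"]
      sums_if[of "\<lambda>n. Im (g n)" "Im y" "\<lambda>n. Im (f n)" "Im x"]
    by (simp_all add: sums_complex_iff)
  then show ?thesis
    by (simp add: sums_complex_iff if_distrib add.commute cong: if_cong)
qed

text \<open>Once the coefficients below \<open>m\<close> vanish, the series at
  \<open>z = (1/4) ^ n\<close> is \<open>z ^ Suc m * h z\<close>, where \<open>h\<close> tends to
  \<open>g m\<close> at 0. Dividing the assumed bound by \<open>z ^ Suc m\<close> shows that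
  \<open>h\<close> tends to 0 along these points. The case \<open>n = 0\<close> is excluded because
  bounded coefficients guarantee convergence only inside the unit disc.\<close>

lemma power_series_flat_zero:
  fixes g :: "nat \<Rightarrow> complex"
  assumes B: "\<And>m. cmod (g m) \<le> B"
    and flat: "\<And>n. n > 0 \<Longrightarrow> cmod (\<Sum>m. g m * ((1/4) ^ n) ^ Suc m) \<le> C * (1/4) ^ (n * n)"
  shows "g m = 0"
proof (induction m rule: less_induct)
  case (less m)
  define h where "h = (\<lambda>w::complex. \<Sum>k. g (k + m) * w ^ k)"
  have summ: "summable (\<lambda>k. g (k + l) * w ^ k)" if "cmod w < 1" for w l
  proof (rule summable_comparison_test')
    show "summable (\<lambda>k. B * cmod w ^ k)" using that by (intro summable_mult summable_geometric) simp
    show "cmod (g (k + l) * w ^ k) \<le> B * cmod w ^ k" for k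
      by (simp add: norm_mult norm_power mult_right_mono B)
  qed
  have "(\<lambda>k. g (k + m) * w ^ k) sums h w" if "cmod w < 1" for w
    unfolding h_def using summ[OF that] by (rule summable_sums)
  then have lim: "(h \<longlongrightarrow> g m) (at 0)"
    using powser_limit_0[of 1 "\<lambda>k. g (k + m)" h] by simp
  have z0: "(\<lambda>n. (1/4::complex) ^ n) \<longlonglongrightarrow> 0" by (rule LIMSEQ_power_zero) simp
  have "filterlim (\<lambda>n. (1/4::complex) ^ n) (at 0) sequentially"
    using z0 by (simp add: filterlim_at)
  then have "(\<lambda>n. h ((1/4) ^ n)) \<longlonglongrightarrow> g m"
    by (rule filterlim_compose[OF lim])
  moreover have "(\<lambda>n. h ((1/4) ^ n)) \<longlonglongrightarrow> 0"
  proof (rule Lim_null_comparison)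
    show "(\<lambda>n. C * (1/4) ^ n) \<longlonglongrightarrow> 0"
      by (intro tendsto_mult_right_zero LIMSEQ_power_zero) simp
    \<comment> \<open>The threshold \<open>m + 2\<close> gives
      \<open>n * n \<ge> n * Suc m + n\<close>, so a factor \<open>(1/4) ^ n\<close> is left after
      the division.\<close>
    have "cmod (h ((1/4) ^ n)) \<le> C * (1/4) ^ n" if n: "n \<ge> m + 2" for n
    proof -
      let ?z = "(1/4::complex) ^ n"
      have z: "cmod ?z < 1" using n by (simp add: norm_power power_less_one_iff)
      have "(\<Sum>k. g k * ?z ^ Suc k) = (\<Sum>k. g (k + m) * ?z ^ Suc (k + m)) + (\<Sum>k<m. g k * ?z ^ Suc k)"
        using summable_mult[OF summ[OF z, of 0], of ?z]
        by (intro suminf_split_initial_segment) (simp add: mult_ac)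
      also have "(\<Sum>k<m. g k * ?z ^ Suc k) = 0" using less by simp
      also have "(\<lambda>k. g (k + m) * ?z ^ Suc (k + m)) = (\<lambda>k. ?z ^ Suc m * (g (k + m) * ?z ^ k))"
        by (simp add: power_add mult_ac)
      also have "(\<Sum>k. ?z ^ Suc m * (g (k + m) * ?z ^ k)) = ?z ^ Suc m * h ?z"
        unfolding h_def by (rule suminf_mult[OF summ[OF z]])
      finally have "cmod (?z ^ Suc m * h ?z) \<le> C * (1/4) ^ (n * n)"
        using flat[of n] n by simp
      then have *: "((1/4) ^ n) ^ Suc m * cmod (h ?z) \<le> C * (1/4) ^ (n * n)"
        by (simp add: norm_mult norm_power)
      have "0 \<le> C" using order_trans[OF norm_ge_zero flat[of 1]] by simp
      have "n * Suc m + n \<le> n * n" using mult_le_mono2[OF n, of n] by (simp add: algebra_simps)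
      then have "C * (1/4::real) ^ (n * n) \<le> C * (1/4) ^ (n * Suc m + n)"
        using \<open>0 \<le> C\<close> by (intro mult_left_mono power_decreasing) auto
      also have "\<dots> = ((1/4) ^ n) ^ Suc m * (C * (1/4) ^ n)"
        by (simp only: power_add power_mult mult_ac)
      finally have "((1/4::real) ^ n) ^ Suc m * cmod (h ?z) \<le> ((1/4) ^ n) ^ Suc m * (C * (1/4) ^ n)"
        using * by linarith
      then show ?thesis by (rule mult_left_le_imp_le) simp
    qed
    then show "\<forall>\<^sub>F n in sequentially. cmod (h ((1/4) ^ n)) \<le> C * (1/4) ^ n"
      by (auto intro: eventually_sequentiallyI)
  qed
  ultimately show ?case by (rule LIMSEQ_unique)
qed

text \<open>The left-hand side of \<open>eq\<close> is the value at \<open>(1/4) ^ n\<close> of one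
  power series, with \<open>b\<close> in the odd and \<open>a\<close> in the even degrees. The
  right-hand side makes it so flat at 0 that all its coefficients vanish.\<close>

lemma independent_ranges:
  assumes a: "a \<in> l2" and b: "b \<in> l2" and c: "c \<in> l2"
    and eq: "\<And>n. kern 2 a n + kern 1 b n = weight n * c n"
  shows "a n = 0" "b n = 0"
proof -
  \<comment> \<open>Since \<open>(2 * n + r) * (2 * k + r) = 2 * n * (2 * k + r) + r * (2 * k +
    r)\<close>, the matrix entry is the power \<open>2 * k + r\<close> of \<open>(1/4) ^ n\<close>
    times a factor free of \<open>n\<close>, which is absorbed into \<open>g\<close>. The index
    \<open>m\<close> belongs to degree \<open>Suc m\<close>, so even \<open>m\<close> carries
    \<open>b\<close>.\<close>
  define g where "g = (\<lambda>m. if even m then (1/2) ^ (2 * (m div 2) + 1) * b (m div 2)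
    else (1/2) ^ (2 * (2 * ((m - 1) div 2) + 2)) * a ((m - 1) div 2))"
  let ?A = "sqrt (l2_sq a)" and ?B = "sqrt (l2_sq b)"
  have shrink: "cmod ((1/2) ^ e * x) \<le> cmod x" for e and x :: complex
    by (simp add: norm_mult norm_power mult_left_le_one_le power_le_one)
  have nonneg: "0 \<le> ?A" "0 \<le> ?B" using a b l2_sq_nonneg by simp_all
  have bound: "cmod (g m) \<le> ?A + ?B" for m
  proof -
    have "cmod (g m) \<le> ?A \<or> cmod (g m) \<le> ?B"
      using order_trans[OF shrink l2_bounded[OF a]] order_trans[OF shrink l2_bounded[OF b]]
      by (auto simp only: g_def split: if_splits)
    then show ?thesis using nonneg by linarith
  qed
  have "(\<lambda>m. g m * ((1/4) ^ n) ^ Suc m) sums (kern 1 b n + kern 2 a n)" for n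
  proof -
    have "(\<lambda>m. if even m then (1/2) ^ ((2 * n + 1) * (2 * (m div 2) + 1)) * b (m div 2)
        else (1/2) ^ ((2 * n + 2) * (2 * ((m - 1) div 2) + 2)) * a ((m - 1) div 2))
      sums (kern 1 b n + kern 2 a n)"
      unfolding kern_def
      by (intro sums_if_complex summable_sums kern_summable[OF _ l2_bounded] a b) simp_all
    moreover have "(if even m then (1/2) ^ ((2 * n + 1) * (2 * (m div 2) + 1)) * b (m div 2)
        else (1/2) ^ ((2 * n + 2) * (2 * ((m - 1) div 2) + 2)) * a ((m - 1) div 2))
      = g m * ((1/4) ^ n) ^ Suc m" for m
    proof -
      have quarter: "((1/4::complex) ^ n) ^ l = (1/2) ^ (2 * n * l)" for l
        by (simp add: power_mult power2_eq_square)
      show ?thesis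
      proof (cases "even m")
        case True
        then obtain k where "m = 2 * k" by (rule evenE)
        then show ?thesis unfolding g_def quarter by (simp flip: power_add add: algebra_simps)
      next
        case False
        then obtain k where "m = 2 * k + 1" by (rule oddE)
        then show ?thesis unfolding g_def quarter by (simp flip: power_add add: algebra_simps)
      qed
    qed
    ultimately show ?thesis by simp
  qed
  then have sum_eq: "(\<Sum>m. g m * ((1/4) ^ n) ^ Suc m) = weight n * c n" for n
    using eq[of n] by (simp add: sums_iff add.commute)
  have "cmod (weight n * c n) \<le> sqrt (l2_sq c) * (1/4) ^ (n * n)" for n
    unfolding norm_mult cmod_weight using l2_bounded[OF c, of n]
    by (simp add: mult.commute mult_right_mono)
  then have zero: "g m = 0" for m
    by (intro power_series_flat_zero[where g = g and C = "sqrt (l2_sq c)", OF bound])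
      (simp only: sum_eq)
  show "b n = 0" using zero[of "2 * n"] by (simp add: g_def)
  show "a n = 0" using zero[of "2 * n + 1"] by (simp add: g_def)
qed


section \<open>The example\<close>

text \<open>With \<open>V\<close> the multiplication by \<^const>\<open>weight\<close>, the operator sends \<open>(V a, b)\<close>
  to \<open>(kern 2 a + kern 1 b, a)\<close>.\<close>

definition quot :: "(real \<Rightarrow> complex) \<Rightarrow> nat \<Rightarrow> complex" where
  "quot h n = first h n / weight n"

text \<open>For \<open>h = (V a, b)\<close>, \<open>quot h\<close> recovers \<open>a\<close> and
  \<open>second h\<close> is \<open>b\<close>. Keeping \<open>a\<close> as the second component of
  the image lets convergence of the images control membership in the domain.\<close>

definition T_op :: "(real \<Rightarrow> complex) unbounded_op" where
  "T_op = \<lparr>op_dom = {h \<in> carrier L2. quot h \<in> l2},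
     op_fun = (\<lambda>h. glue (\<lambda>n. kern 2 (quot h) n + kern 1 (second h) n) (quot h))\<rparr>"

abbreviation "T_adj \<equiv> op_adjoint L2 T_op"

section \<open>Linearity, density and closedness of \<open>T_op\<close>\<close>

lemma quot_simps [simp]:
  "quot (\<lambda>t. h t + k t) = (\<lambda>n. quot h n + quot k n)"
  "quot (\<lambda>t. a * h t) = (\<lambda>n. a * quot h n)"
  "quot (\<lambda>t. 0) = (\<lambda>n. 0)"
  by (simp_all add: quot_def fun_eq_iff add_divide_distrib)

lemma weight_quot: "weight n * quot h n = first h n"
  by (simp add: quot_def)

lemma T_dom: "h \<in> op_dom T_op \<longleftrightarrow> h \<in> carrier L2 \<and> quot h \<in> l2"
  by (simp add: T_op_def)

lemma T_fun [simp]: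
  "first (op_fun T_op h) = (\<lambda>n. kern 2 (quot h) n + kern 1 (second h) n)"
  "second (op_fun T_op h) = quot h"
  by (simp_all add: T_op_def)

lemma T_carrier:
  assumes "h \<in> op_dom T_op"
  shows "op_fun T_op h \<in> carrier L2"
proof -
  have "quot h \<in> l2" "second h \<in> l2" using assms by (simp_all add: T_dom mem_L2)
  then show ?thesis
    unfolding T_op_def unbounded_op.simps by (intro glue_in_L2 l2_add kern_l2) simp_all
qed

lemma linear_T: "linear_op L2 T_op"
proof (rule L2.linear_opI)
  show "op_dom T_op \<subseteq> carrier L2" by (auto simp: T_dom)
  show "\<zero>\<^bsub>L2\<^esub> \<in> op_dom T_op" by (simp add: T_dom L2_zero)
  show "op_fun T_op h \<in> carrier L2" if "h \<in> op_dom T_op" for h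
    using that by (rule T_carrier)
next
  fix h k assume h: "h \<in> op_dom T_op" and k: "k \<in> op_dom T_op"
  then have l2: "quot h \<in> l2" "quot k \<in> l2" "second h \<in> l2" "second k \<in> l2"
    by (simp_all add: T_dom mem_L2)
  have dom: "(\<lambda>t. h t + k t) \<in> op_dom T_op"
    using h k by (simp add: T_dom L2_add l2_add)
  have "op_fun T_op (\<lambda>t. h t + k t) = (\<lambda>t. op_fun T_op h t + op_fun T_op k t)"
    by (intro L2_eqI T_carrier dom L2_add h k) (simp_all add: kern_add l2 algebra_simps)
  then show "h \<oplus>\<^bsub>L2\<^esub> k \<in> op_dom T_op \<and>
      op_fun T_op (h \<oplus>\<^bsub>L2\<^esub> k) = op_fun T_op h \<oplus>\<^bsub>L2\<^esub> op_fun T_op k"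
    using dom by simp
next
  fix h c assume h: "h \<in> op_dom T_op"
  then have l2: "quot h \<in> l2" "second h \<in> l2" by (simp_all add: T_dom mem_L2)
  have dom: "(\<lambda>t. c * h t) \<in> op_dom T_op"
    using h by (simp add: T_dom L2_smult l2_smult)
  have "op_fun T_op (\<lambda>t. c * h t) = (\<lambda>t. c * op_fun T_op h t)"
    by (intro L2_eqI T_carrier dom L2_smult h) (simp_all add: kern_smult l2 algebra_simps)
  then show "c \<odot>\<^bsub>L2\<^esub> h \<in> op_dom T_op \<and> op_fun T_op (c \<odot>\<^bsub>L2\<^esub> h) = c \<odot>\<^bsub>L2\<^esub> op_fun T_op h"
    using dom by simp
qed

text \<open>Cutting the first component off after finitely many coordinates makes
  \<open>quot\<close> finitely supported, whatever the second component is; the error is a tail of a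
  convergent series.\<close>

lemma dense_T: "densely_defined L2 T_op"
proof -
  have "\<exists>k\<in>op_dom T_op. k \<in> L2.mball h r" if h: "h \<in> carrier L2" and r: "r > 0" for h r
  proof -
    have l2: "first h \<in> l2" "second h \<in> l2" using h by (simp_all add: mem_L2)
    obtain m where m: "norm (\<Sum>n. (cmod (first h (n + m)))\<^sup>2) < r\<^sup>2"
      using suminf_exist_split[of "r\<^sup>2", OF _ l2D[OF l2(1)]] r by auto
    define f where "f = (\<lambda>n. if n < m then first h n else 0)"
    let ?k = "glue f (second h)"
    have "f \<in> l2" "quot ?k \<in> l2"
      by (rule l2_finite_support, rule finite_subset[of _ "{..<m}"], auto simp: f_def quot_def)+
    then have k: "?k \<in> op_dom T_op" by (simp add: T_dom glue_in_L2 l2)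
    then have kL2: "?k \<in> carrier L2" by (simp add: T_dom)
    have "l2_sq (\<lambda>n. first h n - f n) = (\<Sum>n. (cmod (first h (n + m)))\<^sup>2)"
      unfolding l2_sq_def
      by (subst suminf_split_initial_segment[OF l2D[OF l2_diff[OF l2(1) \<open>f \<in> l2\<close>]], of m])
        (simp add: f_def)
    then have "hdist L2 h ?k < sqrt (r\<^sup>2)"
      unfolding hdist_L2[OF h kL2] using m by (intro real_sqrt_less_mono) (simp add: l2_sq_def)
    then show ?thesis using k kL2 h r by (intro bexI[of _ ?k]) simp_all
  qed
  then show ?thesis
    unfolding densely_defined_def L2.metric_closure_of by blast
qed

text \<open>By \<open>kern_le\<close> each value of \<open>kern r\<close> is controlled by a uniform
  bound on the coordinates, so the norm distance can serve as \<open>d\<close>.\<close>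

lemma tendsto_kern:
  assumes "r > 0" "\<And>i. a i \<in> l2" "b \<in> l2"
    and close: "\<And>i k. cmod (a i k - b k) \<le> d i" and d: "d \<longlonglongrightarrow> 0"
  shows "(\<lambda>i. kern r (a i) n) \<longlonglongrightarrow> kern r b n"
proof (rule Lim_transform2[OF tendsto_const])
  show "(\<lambda>i. kern r b n - kern r (a i) n) \<longlonglongrightarrow> 0"
  proof (rule Lim_null_comparison)
    have "cmod (kern r b n - kern r (a i) n) \<le> d i * (1/2) ^ n" for i
    proof -
      have "kern r (a i) n = kern r (\<lambda>k. a i k - b k) n + kern r b n"
        using kern_add[OF assms(1) l2_diff[OF assms(2,3)] assms(3), of i n] by simp
      then have "cmod (kern r b n - kern r (a i) n) = cmod (kern r (\<lambda>k. a i k - b k) n)"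
        by (simp add: norm_minus_commute)
      then show ?thesis using kern_le[OF assms(1) close[of i], where n = n] by simp
    qed
    then show "\<forall>\<^sub>F i in sequentially. cmod (kern r b n - kern r (a i) n) \<le> d i * (1/2) ^ n"
      by simp
    show "(\<lambda>i. d i * (1/2) ^ n) \<longlonglongrightarrow> 0" using d by (rule tendsto_mult_left_zero)
  qed
qed

interpretation L2L2: Metric_space12 "carrier L2" "hdist L2" "carrier L2" "hdist L2"
  by unfold_locales

text \<open>If \<open>x i\<close> tends to \<open>u\<close> and \<open>T_op (x i)\<close> to
  \<open>v\<close>, then \<open>quot (x i)\<close> is the second half of the image and tends to that
  of \<open>v\<close>. So \<open>quot u = second v\<close> is in \<open>l2\<close>, and
  \<open>u\<close> is in the domain. The first halves agree by continuity of
  \<open>kern\<close>.\<close>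

lemma closed_T: "closed_op L2 T_op"
  unfolding closed_op_def L2L2.Prod_metric.metric_closedin_iff_sequentially_closed
proof (intro conjI allI impI)
  show "op_graph T_op \<subseteq> carrier L2 \<times> carrier L2"
    using T_carrier by (auto simp: op_graph_def T_dom)
next
  fix \<sigma> l
  assume \<sigma>: "range \<sigma> \<subseteq> op_graph T_op \<and> limitin L2L2.Prod_metric.mtopology \<sigma> l sequentially"
  define x where "x = (\<lambda>i. fst (\<sigma> i))"
  define y where "y = (\<lambda>i. snd (\<sigma> i))"
  obtain u v where l: "l = (u, v)" by (cases l)
  have graph: "\<sigma> i \<in> op_graph T_op" for i using \<sigma> by auto
  have dom: "x i \<in> op_dom T_op" and y_eq: "y i = op_fun T_op (x i)" for i
    using graph[of i] by (auto simp: x_def y_def op_graph_def)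
  then have xL2: "x i \<in> carrier L2" and yL2: "y i \<in> carrier L2" for i
    using T_carrier by (auto simp: T_dom)
  have uL2: "u \<in> carrier L2" and vL2: "v \<in> carrier L2"
    and lim: "\<And>e. e > 0 \<Longrightarrow> \<exists>N. \<forall>i\<ge>N. prod_dist (hdist L2) (hdist L2) (\<sigma> i) (u, v) < e"
    using \<sigma> by (auto simp: L2L2.Prod_metric.limit_metric_sequentially l) blast
  have \<sigma>_eq: "\<sigma> i = (x i, y i)" for i by (simp add: x_def y_def)
  have dx: "(\<lambda>i. hdist L2 (x i) u) \<longlonglongrightarrow> 0"
  proof (rule LIMSEQ_I)
    fix e :: real assume "e > 0"
    then show "\<exists>N. \<forall>i\<ge>N. norm (hdist L2 (x i) u - 0) < e"
      using lim[of e] L2.nonneg L2L2.component_le_prod_metric(1) unfolding \<sigma>_eq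
      by (simp add: abs_of_nonneg) (meson order_le_less_trans)
  qed
  have dy: "(\<lambda>i. hdist L2 (y i) v) \<longlonglongrightarrow> 0"
  proof (rule LIMSEQ_I)
    fix e :: real assume "e > 0"
    then show "\<exists>N. \<forall>i\<ge>N. norm (hdist L2 (y i) v - 0) < e"
      using lim[of e] L2.nonneg L2L2.component_le_prod_metric(2) unfolding \<sigma>_eq
      by (simp add: abs_of_nonneg) (meson order_le_less_trans)
  qed
  have xlim: "(\<lambda>i. x i t) \<longlonglongrightarrow> u t" for t
    using coord_diff_le_hdist[OF xL2 uL2]
    by (intro LIM_zero_cancel[OF Lim_null_comparison[OF _ dx]]) simp
  have ylim: "(\<lambda>i. y i t) \<longlonglongrightarrow> v t" for t
    using coord_diff_le_hdist[OF yL2 vL2]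
    by (intro LIM_zero_cancel[OF Lim_null_comparison[OF _ dy]]) simp
  have l2: "second (x i) \<in> l2" "second (y i) \<in> l2" "second u \<in> l2" "second v \<in> l2" for i
    using xL2 yL2 uL2 vL2 by (simp_all add: mem_L2)
  have quot_u: "quot u = second v"
  proof
    fix n
    have "(\<lambda>i. quot (x i) n) \<longlonglongrightarrow> quot u n"
      unfolding quot_def first_def by (intro tendsto_intros xlim) simp
    moreover have "(\<lambda>i. quot (x i) n) \<longlonglongrightarrow> second v n"
    proof -
      have "second (y i) n = quot (x i) n" for i by (simp add: y_eq)
      then show ?thesis using ylim[of "- 1 - real n"] by (simp add: second_def)
    qed
    ultimately show "quot u n = second v n" by (rule LIMSEQ_unique)
  qed
  have udom: "u \<in> op_dom T_op" using uL2 l2 by (simp add: T_dom quot_u)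
  have "v = op_fun T_op u"
  proof (intro L2_eqI vL2 T_carrier udom)
    show "second v = second (op_fun T_op u)" by (simp add: quot_u)
    show "first v = first (op_fun T_op u)"
    proof
      fix n
      have "(\<lambda>i. kern 2 (second (y i)) n) \<longlonglongrightarrow> kern 2 (second v) n"
        using coord_diff_le_hdist[OF yL2 vL2] unfolding second_def
        by (intro tendsto_kern[OF _ _ _ _ dy] l2[unfolded second_def]) simp_all
      moreover have "(\<lambda>i. kern 1 (second (x i)) n) \<longlonglongrightarrow> kern 1 (second u) n"
        using coord_diff_le_hdist[OF xL2 uL2] unfolding second_def
        by (intro tendsto_kern[OF _ _ _ _ dx] l2[unfolded second_def]) simp_all
      ultimately have "(\<lambda>i. kern 2 (second (y i)) n + kern 1 (second (x i)) n)
          \<longlonglongrightarrow> kern 2 (second v) n + kern 1 (second u) n"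
        by (rule tendsto_add)
      moreover have "kern 2 (second (y i)) n + kern 1 (second (x i)) n = first (y i) n" for i
        by (simp add: y_eq)
      ultimately have "(\<lambda>i. first (y i) n) \<longlonglongrightarrow> kern 2 (second v) n + kern 1 (second u) n"
        by simp
      moreover have "(\<lambda>i. first (y i) n) \<longlonglongrightarrow> first v n"
        using ylim by (simp add: first_def)
      ultimately show "first v n = first (op_fun T_op u) n"
        using LIMSEQ_unique by (fastforce simp: quot_u)
    qed
  qed
  then show "l \<in> op_graph T_op" using udom by (auto simp: op_graph_def l)
qed

text \<open>That the image lies in the domain says that its first half is \<open>weight\<close>
  times an \<open>l2\<close> sequence, which is the equation excluded by
  \<open>independent_ranges\<close>.\<close>

lemma T_square_trivial:
  assumes h: "h \<in> op_dom T_op" and Th: "op_fun T_op h \<in> op_dom T_op"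
  shows "h = \<zero>\<^bsub>L2\<^esub>"
proof -
  have l2: "quot h \<in> l2" "second h \<in> l2" "quot (op_fun T_op h) \<in> l2"
    using h Th by (simp_all add: T_dom mem_L2)
  have "kern 2 (quot h) n + kern 1 (second h) n = weight n * quot (op_fun T_op h) n" for n
    by (simp add: weight_quot)
  from independent_ranges[OF l2 this] have z: "quot h n = 0" "second h n = 0" for n .
  then have "first h = (\<lambda>n. 0)" "second h = (\<lambda>n. 0)"
    using weight_quot[of _ h] by (auto simp: fun_eq_iff)
  then show ?thesis
    using h L2_zero by (intro L2_eqI) (simp_all add: T_dom)
qed

section \<open>The adjoint and its square\<close>

lemma basis_in_T_dom:
  "glue (\<lambda>n. weight j * unit_seq j n) (\<lambda>n. 0) \<in> op_dom T_op"
  "glue (\<lambda>n. 0) (unit_seq j) \<in> op_dom T_op"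
  and quot_basis:
  "quot (glue (\<lambda>n. weight j * unit_seq j n) (\<lambda>n. 0)) = unit_seq j"
  "quot (glue (\<lambda>n. 0) (unit_seq j)) = (\<lambda>n. 0)"
proof -
  \<comment> \<open>The factor \<open>weight j\<close> cancels in \<open>quot\<close>, so that
    \<open>T_op\<close> acts on these test vectors through plain basis sequences.\<close>
  show q: "quot (glue (\<lambda>n. weight j * unit_seq j n) (\<lambda>n. 0)) = unit_seq j"
    "quot (glue (\<lambda>n. 0) (unit_seq j)) = (\<lambda>n. 0)"
    by (auto simp: quot_def unit_seq_def)
  show "glue (\<lambda>n. weight j * unit_seq j n) (\<lambda>n. 0) \<in> op_dom T_op"
    "glue (\<lambda>n. 0) (unit_seq j) \<in> op_dom T_op"
    unfolding T_dom q by (simp_all add: glue_in_L2 l2_smult)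
qed

lemma cinner_basis:
  assumes "h \<in> carrier L2"
  shows "cinner L2 (glue (\<lambda>n. weight j * unit_seq j n) (\<lambda>n. 0)) h = weight j * cnj (first h j)"
    and "cinner L2 (glue (\<lambda>n. 0) (unit_seq j)) h = cnj (second h j)"
  using assms by (simp_all add: l2_inner_smult_left l2_inner_unit_left mem_L2)

text \<open>The test vectors detect every coordinate, because the weights are nonzero.\<close>

lemma T_dom_separating:
  "\<forall>z\<in>carrier L2. (\<forall>x\<in>op_dom T_op. cinner L2 x z = 0) \<longrightarrow> z = \<zero>\<^bsub>L2\<^esub>"
proof (intro ballI impI)
  fix z assume z: "z \<in> carrier L2" and orth: "\<forall>x\<in>op_dom T_op. cinner L2 x z = 0"
  have "first z j = 0" "second z j = 0" for j
    using bspec[OF orth basis_in_T_dom(1)[of j]] bspec[OF orth basis_in_T_dom(2)[of j]]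
    unfolding cinner_basis[OF z] by simp_all
  then have "first z = (\<lambda>n. 0)" "second z = (\<lambda>n. 0)" by (simp_all add: fun_eq_iff)
  then show "z = \<zero>\<^bsub>L2\<^esub>" using z L2_zero by (intro L2_eqI) simp_all
qed

lemmas T_adj_eqI = L2.op_adjoint_eqI[OF linear_T T_dom_separating]
lemmas T_adjD = L2.op_adjointD[OF linear_T T_dom_separating]
lemmas linear_T_adj = L2.linear_op_adjoint[OF linear_T T_dom_separating]

text \<open>Testing the adjoint relation on the vectors \<open>(V e, 0)\<close> and
  \<open>(0, e)\<close>, with \<open>e\<close> a basis sequence, gives one coordinate equation each.
  Together they say that the adjoint acts by
  \<open>(u, V v - kern 2 u) \<mapsto> (v, kern 1 u)\<close>.\<close>

lemma T_adj_coords: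
  assumes u: "u \<in> op_dom T_adj"
  shows "kern 2 (first u) n + second u n = weight n * first (op_fun T_adj u) n"
    and "second (op_fun T_adj u) n = kern 1 (first u) n"
proof -
  define v where "v = op_fun T_adj u"
  have uL2: "u \<in> carrier L2" and vL2: "v \<in> carrier L2"
    and adj: "\<And>x. x \<in> op_dom T_op \<Longrightarrow> cinner L2 (op_fun T_op x) u = cinner L2 x v"
    using T_adjD[OF u] by (auto simp: v_def)
  have l2: "first u \<in> l2" using uL2 by (simp add: mem_L2)
  have "cnj (kern 2 (first u) n) + cnj (second u n) = weight n * cnj (first v n)"
    using adj[OF basis_in_T_dom(1)[of n]] unfolding cinner_basis[OF vL2]
    by (simp add: quot_basis l2_inner_kern_unit l2 l2_inner_unit_left)
  \<comment> \<open>The inner product is conjugate-linear on the right, so the coordinates arrive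
    conjugated; the weights are real.\<close>
  from arg_cong[OF this, of cnj]
  show "kern 2 (first u) n + second u n = weight n * first (op_fun T_adj u) n"
    by (simp add: v_def)
  have "cnj (kern 1 (first u) n) = cnj (second v n)"
    using adj[OF basis_in_T_dom(2)[of n]] unfolding cinner_basis[OF vL2]
    by (simp add: quot_basis l2_inner_kern_unit l2)
  then show "second (op_fun T_adj u) n = kern 1 (first u) n"
    by (simp add: v_def)
qed

text \<open>The second half of \<open>v\<close> is \<open>kern 1 (first u)\<close>. Inserted into
  the first coordinate equation of \<open>v\<close>, it yields the relation of
  \<open>independent_ranges\<close>, which kills the first halves of \<open>u\<close> and
  \<open>v\<close>; the first equation of \<open>u\<close> then kills its second half.\<close>

lemma T_adj_square_trivial:
  assumes u: "u \<in> op_dom T_adj" and v: "op_fun T_adj u \<in> op_dom T_adj"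
  shows "u = \<zero>\<^bsub>L2\<^esub>"
proof -
  define v w where "v = op_fun T_adj u" and "w = op_fun T_adj v"
  have L2: "u \<in> carrier L2" "v \<in> carrier L2" "w \<in> carrier L2"
    using T_adjD[OF u] T_adjD[OF v] by (auto simp: v_def w_def)
  then have l2: "first v \<in> l2" "first u \<in> l2" "first w \<in> l2" by (simp_all add: mem_L2)
  have "kern 2 (first v) n + kern 1 (first u) n = weight n * first w n" for n
    using T_adj_coords(1)[OF v, of n] T_adj_coords(2)[OF u, of n] by (simp add: v_def w_def)
  from independent_ranges[OF l2 this]
  have z: "first v = (\<lambda>n. 0)" "first u = (\<lambda>n. 0)" by (simp_all add: fun_eq_iff)
  then have "second u n = 0" for n
    using T_adj_coords(1)[OF u, folded v_def, of n] by simp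
  then have "second u = (\<lambda>n. 0)" by (simp add: fun_eq_iff)
  then show ?thesis using z L2 L2_zero by (intro L2_eqI) simp_all
qed

text \<open>The vector \<open>(e, - kern 2 e)\<close>, with \<open>e\<close> the zeroth basis sequence, is in the domain of
  \<open>T T\<^sup>*\<close> but not in that of \<open>T\<^sup>* T\<close>.\<close>

lemma T_not_normal: "\<not> normal_op L2 T_op"
proof
  assume "normal_op L2 T_op"
  then have dom_eq: "op_dom (op_comp T_op T_adj) = op_dom (op_comp T_adj T_op)"
    by (simp add: normal_op_def op_eq_def)
  let ?e = "unit_seq 0"
  \<comment> \<open>This is \<open>V v - kern 2 e\<close> with \<open>v = 0\<close>, so the first
    half of the adjoint image \<open>z\<close> is zero.\<close>
  define s where "s = (\<lambda>n. - 1 * kern 2 ?e n)"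
  define u where "u = glue ?e s"
  define z where "z = glue (\<lambda>n. 0) (kern 1 ?e)"
  have s: "s \<in> l2" unfolding s_def by (intro l2_smult kern_l2) simp_all
  have uL2: "u \<in> carrier L2" and zL2: "z \<in> carrier L2"
    unfolding u_def z_def by (simp_all add: glue_in_L2 s kern_l2)
  have "u \<in> op_dom T_adj \<and> op_fun T_adj u = z"
  proof (rule T_adj_eqI)
    fix x assume x: "x \<in> op_dom T_op"
    then have l2: "quot x \<in> l2" "second x \<in> l2" by (simp_all add: T_dom mem_L2)
    have kern_right: "l2_inner f (kern r ?e) = kern r f 0" if "f \<in> l2" "r > 0" for f r
      using l2_inner_commute[of "kern r ?e" f] l2_inner_kern_unit[OF that(2,1), of 0] that
      by (simp add: kern_l2)
    \<comment> \<open>This cancels the contribution of \<open>kern 2 (quot x)\<close> to the inner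
      product with \<open>u\<close>, leaving only the term in \<open>second x\<close>.\<close>
    have "l2_inner (quot x) s = - kern 2 (quot x) 0"
      using l2_inner_commute[OF s l2(1)] l2_inner_smult_left[of "kern 2 ?e" "quot x" "-1"]
        l2_inner_kern_unit[of 2 "quot x" 0] l2
      by (simp add: s_def kern_l2)
    then show "cinner L2 (op_fun T_op x) u = cinner L2 x z"
      by (simp add: u_def z_def l2_inner_unit_right kern_right l2)
  qed (fact uL2 zL2)+
  moreover have "quot z = (\<lambda>n. 0)" by (simp add: quot_def z_def fun_eq_iff)
  then have "z \<in> op_dom T_op" using zL2 by (simp add: T_dom)
  ultimately have "u \<in> op_dom (op_comp T_op T_adj)" by (simp add: op_comp_def)
  then have "u \<in> op_dom (op_comp T_adj T_op)" by (simp only: dom_eq)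
  then have Tu: "op_fun T_op u \<in> op_dom T_adj" by (simp add: op_comp_def)
  define f where "f = first (op_fun T_op u)"
  define w where "w = op_fun T_adj (op_fun T_op u)"
  have quot_u: "quot u = ?e" by (auto simp: quot_def u_def unit_seq_def)
  have f: "f \<in> l2" and w: "first w \<in> l2"
    using T_adjD[OF Tu] by (simp_all add: f_def w_def mem_L2)
  \<comment> \<open>The second half of \<open>T_op u\<close> is \<open>e\<close>, so the adjoint
    equation reads \<open>kern 2 f + e = V (first w)\<close>. As \<open>weight 0 = 1\<close>, also
    \<open>e = V e\<close>, and \<open>e\<close> can be moved to the right.\<close>
  have "kern 2 f n + kern 1 (\<lambda>k. 0) n = weight n * (first w n - ?e n)" for n
  proof -
    have "kern 2 f n + ?e n = weight n * first w n"
      using T_adj_coords(1)[OF Tu, of n] by (simp add: f_def w_def quot_u)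
    moreover have "weight n * ?e n = ?e n" by (simp add: unit_seq_def)
    ultimately show ?thesis by (simp only: kern_zero right_diff_distrib add_0_right eq_diff_eq)
  qed
  \<comment> \<open>The first use gives \<open>f = 0\<close>, that is,
    \<open>kern 2 e + kern 1 s = 0\<close>; the second use turns this into \<open>e = 0\<close>,
    which is false at index 0.\<close>
  from independent_ranges(1)[OF f l2_zero l2_diff[OF w unit_seq_l2] this]
  have "kern 2 ?e n + kern 1 s n = weight n * 0" for n
    by (simp add: f_def quot_u) (simp add: u_def)
  from independent_ranges(1)[OF unit_seq_l2 s l2_zero this, of 0]
  show False by (simp add: unit_seq_def)
qed

theorem theorem2p1:
  shows "\<exists>(H :: (real \<Rightarrow> complex) cinner_space) (T :: (real \<Rightarrow> complex) unbounded_op).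
    complex_hilbert_space H \<and>
    linear_op H T \<and> densely_defined H T \<and> closed_op H T \<and>
    one_to_one T \<and> paranormal H T \<and>
    one_to_one (op_adjoint H T) \<and> paranormal H (op_adjoint H T) \<and>
    \<not> normal_op H T"
proof (intro exI conjI)
  show "complex_hilbert_space L2" by (rule L2.complex_hilbert_space_axioms)
  show "one_to_one T_op" "paranormal L2 T_op"
    by (rule L2.trivial_square[OF linear_T T_square_trivial]; assumption)+
  show "one_to_one T_adj" "paranormal L2 T_adj"
    by (rule L2.trivial_square[OF linear_T_adj T_adj_square_trivial]; assumption)+
qed (fact linear_T dense_T closed_T T_not_normal)+

end
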